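(* Let $G$ be a finite abstract simplicial complex, let $U,V\subseteq G$ be open sets, and let $m\ge1$ be an integer. Then $$ w_m(U\cup V)=w_m(U)+w_m(V)-w_m(U\cap V). $$
   Context: A finite abstract simplicial complex $G$ is a finite set of non-empty finite sets, closed under taking non-empty subsets. For $x\in G$, $\dim(x)=|x|-1$ and $w(x)=(-1)^{\dim(x)}$. The stars $U(x)=\{y\in G : x\subseteq y\}$ form a base of a finite topology on $G$; thus $U\subseteq G$ is open iff $x\in U$, $y\in G$, $x\subseteq y$ imply $y\in U$. For any subset $A\subseteq G$, $$ w_m(A)=\sum_{(x_1,\dots,x_m)\in A^m,\ x_1\cap\cdots\cap x_m\in A}\ \prod_{j=1}^m w(x_j), $$ with $w_m(\emptyset)=0$. *)

theory Defs
  imports "HOL-Analysis.Analysis"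
begin

definition abstract_simplicial_complex :: "'a set set \<Rightarrow> bool" where
  "abstract_simplicial_complex G \<longleftrightarrow> finite G \<and> (\<forall>x\<in>G. finite x \<and> x \<noteq> {}) \<and>
     (\<forall>x\<in>G. \<forall>y. y \<subseteq> x \<and> y \<noteq> {} \<longrightarrow> y \<in> G)"

(* Simplices are nonempty, so the subtraction on nat never truncates on a complex. *)
definition simplex_dim :: "'a set \<Rightarrow> nat" where
  "simplex_dim x = card x - 1"

definition simplex_weight :: "'a set \<Rightarrow> int" where
  "simplex_weight x = (-1) ^ simplex_dim x"

definition simplex_star :: "'a set set \<Rightarrow> 'a set \<Rightarrow> 'a set set" where
  "simplex_star G x = {y \<in> G. x \<subseteq> y}"

(* The open sets are the arbitrary unions of stars of simplices of G. *)
definition star_topology :: "'a set set \<Rightarrow> 'a set topology" where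
  "star_topology G = topology (arbitrary union_of (\<lambda>S. S \<in> simplex_star G ` G))"

(* An m-tuple of elements of A is an extensional function on {1..m}.
   Only m \<ge> 1 is meaningful: for m = 0 the intersection would be UNIV. *)
definition w_char :: "nat \<Rightarrow> 'a set set \<Rightarrow> int" where
  "w_char m A = (\<Sum>x | x \<in> {1..m} \<rightarrow>\<^sub>E A \<and> (\<Inter>j\<in>{1..m}. x j) \<in> A.
                   \<Prod>j=1..m. simplex_weight (x j))"

lemma w_char_empty: "m \<ge> 1 \<Longrightarrow> w_char m {} = 0"
  by (simp add: w_char_def)

lemma union_of_stars_iff:
  "(arbitrary union_of (\<lambda>S. S \<in> simplex_star G ` G)) U \<longleftrightarrow>
     U \<subseteq> G \<and> (\<forall>x\<in>U. \<forall>y\<in>G. x \<subseteq> y \<longrightarrow> y \<in> U)" (is "?L = ?R")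
proof
  assume ?L
  then obtain F where F: "F \<subseteq> simplex_star G ` G" "\<Union>F = U"
    by (auto simp: union_of_def arbitrary_def)
  show ?R
  proof (intro conjI ballI impI)
    show "U \<subseteq> G"
      using F by (auto simp: simplex_star_def)
  next
    fix x y assume x: "x \<in> U" and y: "y \<in> G" "x \<subseteq> y"
    obtain z where z: "z \<in> G" "simplex_star G z \<in> F" "x \<in> simplex_star G z"
      using F x by blast
    then have "y \<in> simplex_star G z"
      using y by (auto simp: simplex_star_def)
    then show "y \<in> U"
      using z F by blast
  qed
next
  assume R: ?R
  have "\<Union>(simplex_star G ` U) = U"
    using R by (auto simp: simplex_star_def)
  moreover have "simplex_star G ` U \<subseteq> simplex_star G ` G"
    using R by blast
  ultimately show ?L
    by (auto simp: union_of_def arbitrary_def intro!: exI[of _ "simplex_star G ` U"])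
qed

lemma openin_star_topology_iff:
  "openin (star_topology G) U \<longleftrightarrow> U \<subseteq> G \<and> (\<forall>x\<in>U. \<forall>y\<in>G. x \<subseteq> y \<longrightarrow> y \<in> U)"
proof -
  have "istopology (arbitrary union_of (\<lambda>S. S \<in> simplex_star G ` G))"
    unfolding istopology_def union_of_stars_iff by blast
  then have "openin (star_topology G) = arbitrary union_of (\<lambda>S. S \<in> simplex_star G ` G)"
    unfolding star_topology_def by (rule topology_inverse')
  then show ?thesis
    by (simp only: union_of_stars_iff)
qed

lemma topspace_star_topology: "topspace (star_topology G) = G"
proof
  show "topspace (star_topology G) \<subseteq> G"
    using openin_topspace[of "star_topology G"] unfolding openin_star_topology_iff by simp
  show "G \<subseteq> topspace (star_topology G)"
    by (rule openin_subset) (simp add: openin_star_topology_iff)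
qed

end

theory Submission
  imports Defs
begin

text \<open>If the intersection of simplices \<open>x\<^sub>1, \<dots>, x\<^sub>m\<close> of \<open>G\<close> lies in an open set \<open>A\<close>, then so does
  every \<open>x\<^sub>j\<close>, since it contains the intersection. For open \<open>A\<close> the tuples in the sum
  may therefore range over all of \<open>G\<^sup>m\<close>, only the intersection being required to lie in \<open>A\<close>;
  this set of tuples is a preimage of \<open>A\<close>, hence compatible with unions and intersections.\<close>

lemma w_char_openin:
  assumes "openin (star_topology G) A"
  shows "w_char m A = (\<Sum>x | x \<in> {1..m} \<rightarrow>\<^sub>E G \<and> (\<Inter>j\<in>{1..m}. x j) \<in> A.
                         \<Prod>j=1..m. simplex_weight (x j))"
proof -
  have sub: "A \<subseteq> G" and up: "\<And>x y. x \<in> A \<Longrightarrow> y \<in> G \<Longrightarrow> x \<subseteq> y \<Longrightarrow> y \<in> A"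
    using assms unfolding openin_star_topology_iff by auto
  have "x \<in> {1..m} \<rightarrow>\<^sub>E A \<longleftrightarrow> x \<in> {1..m} \<rightarrow>\<^sub>E G" if "(\<Inter>j\<in>{1..m}. x j) \<in> A" for x
  proof
    show "x \<in> {1..m} \<rightarrow>\<^sub>E G" if "x \<in> {1..m} \<rightarrow>\<^sub>E A"
      using that sub by (auto simp: PiE_iff)
  next
    assume x: "x \<in> {1..m} \<rightarrow>\<^sub>E G"
    have "x j \<in> A" if "j \<in> {1..m}" for j
      using up[OF \<open>(\<Inter>j\<in>{1..m}. x j) \<in> A\<close> PiE_mem[OF x that] INF_lower[OF that]] .
    with x show "x \<in> {1..m} \<rightarrow>\<^sub>E A"
      by (simp add: PiE_iff)
  qed
  then show ?thesis
    unfolding w_char_def by (intro sum.cong) auto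
qed

theorem lemma1:
  fixes G U V :: "'a set set" and m :: nat
  assumes "abstract_simplicial_complex G"
    and "openin (star_topology G) U"
    and "openin (star_topology G) V"
    and "m \<ge> 1"
  shows "w_char m (U \<union> V) = w_char m U + w_char m V - w_char m (U \<inter> V)"
proof -
  \<comment> \<open>The tuples range over the fixed set \<open>G\<close>, so \<open>A\<close> enters
    \<open>T A\<close> only through the intersection condition. Hence \<open>T\<close> commutes with
    unions and intersections for arbitrary \<open>A\<close>; openness serves only to identify
    \<open>w_char m A\<close> with a sum over \<open>T A\<close>.\<close>
  define T where "T A = {x \<in> {1..m} \<rightarrow>\<^sub>E G. (\<Inter>j\<in>{1..m}. x j) \<in> A}" for A
  define f where "f x = (\<Prod>j=1..m. simplex_weight (x j))" for x :: "nat \<Rightarrow> 'a set"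
  have w: "w_char m A = sum f (T A)" if "openin (star_topology G) A" for A
    unfolding T_def f_def by (rule w_char_openin[OF that])
  \<comment> \<open>Sums over infinite sets default to 0, so inclusion-exclusion for
    \<open>sum\<close> relies on finite index sets.\<close>
  have "finite ({1..m} \<rightarrow>\<^sub>E G)"
    using assms(1) by (intro finite_PiE) (auto simp: abstract_simplicial_complex_def)
  then have "finite (T A)" for A
    by (simp add: T_def)
  then have "sum f (T U \<union> T V) = sum f (T U) + sum f (T V) - sum f (T U \<inter> T V)"
    by (intro sum_Un)
  moreover have "T U \<union> T V = T (U \<union> V)" "T U \<inter> T V = T (U \<inter> V)"
    by (auto simp: T_def)
  \<comment> \<open>\<open>w\<close> applies to all four sets, since \<open>U \<union> V\<close> and
    \<open>U \<inter> V\<close> are open too.\<close>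
  ultimately show ?thesis
    using assms(2,3) by (simp add: w openin_Un openin_Int)
qed

end
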